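(* Let $\mu$ be a Borel probability measure on $\mathbb{R}^2$ assigning measure zero to every affine line. Suppose that $\mu$ is invariant under an orientation-reversing affine involution, i.e. there is an affine map $R(x)=Lx+b$ with $R\circ R=\mathrm{id}$, $\det L<0$ and $R_*\mu=\mu$. Then, for every $0\le t\le 1/4$, there exist two orthogonal lines whose four regions, in cyclic order, have $\mu$-masses $$t,\quad t,\quad \tfrac12-t,\quad \tfrac12-t .$$
   Context: Two orthogonal lines divide the plane into four open quadrant-shaped regions, listed in cyclic order around the intersection point. Convention: at the endpoint $t=0$ the degenerate partition consisting of a single line, with each of its two half-planes of mass $1/2$, is allowed as a partition with masses $0,0,\tfrac12,\tfrac12$. $R_*\mu$ denotes the pushforward, $(R_*\mu)(E)=\mu(R^{-1}(E))$. *)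

theory Defs
  imports "HOL-Probability.Probability"
begin

definition is_line :: "(real^2) set \<Rightarrow> bool" where
  "is_line l \<longleftrightarrow> affine l \<and> aff_dim l = 1"

lemma is_line_iff_hyperplane:
  "is_line l \<longleftrightarrow> (\<exists>a c. a \<noteq> 0 \<and> l = {x. a \<bullet> x = c})"
proof
  assume "is_line l"
  then show "\<exists>a c. a \<noteq> 0 \<and> l = {x. a \<bullet> x = c}"
    using aff_dim_eq_hyperplane[of l] by (auto simp: is_line_def) (metis affine_hull_eq)
next
  assume "\<exists>a c. a \<noteq> 0 \<and> l = {x. a \<bullet> x = c}"
  then show "is_line l"
    by (auto simp: is_line_def affine_hyperplane aff_dim_hyperplane)
qed

definition open_half_planes :: "(real^2) set \<Rightarrow> (real^2) set \<Rightarrow> (real^2) set \<Rightarrow> bool" where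
  "open_half_planes l H K \<longleftrightarrow>
     (\<exists>a c. a \<noteq> 0 \<and> l = {x. a \<bullet> x = c} \<and> H = {x. a \<bullet> x > c} \<and> K = {x. a \<bullet> x < c})"

text \<open>
  The lines with normals \<open>a\<close> and \<open>b\<close> are orthogonal iff their normals are. Consecutive regions in
  the list (and the last and the first) lie on opposite sides of exactly one of the two lines, so
  the list goes once around the intersection point. Replacing the normals by their negatives and
  exchanging the lines yields every choice of first region and both senses of rotation.
\<close>
definition orthogonal_regions ::
  "(real^2) set \<Rightarrow> (real^2) set \<Rightarrow> (real^2) set list \<Rightarrow> bool" where
  "orthogonal_regions l m Qs \<longleftrightarrow>
     (\<exists>a c b d. a \<noteq> 0 \<and> b \<noteq> 0 \<and> orthogonal a b \<and>
        l = {x. a \<bullet> x = c} \<and> m = {x. b \<bullet> x = d} \<and>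
        Qs = [{x. a \<bullet> x > c \<and> b \<bullet> x > d}, {x. a \<bullet> x < c \<and> b \<bullet> x > d},
              {x. a \<bullet> x < c \<and> b \<bullet> x < d}, {x. a \<bullet> x > c \<and> b \<bullet> x < d}])"

end

theory Submission
  imports Defs
begin

text \<open>
  For a unit vector \<open>b\<close> cut off a half-plane \<open>{x. b \<bullet> x > d}\<close> of mass \<open>2t\<close>, bisect the plane by a
  line with normal \<open>rot b\<close>, and let \<open>\<phi>(b)\<close> be the mass of the quadrant on the positive side of
  both lines; a solution is a zero of \<open>\<phi> - t\<close>. Some orthonormal frame is mapped by the linear part
  of \<open>R\<close> (acting on normals) to an orthogonal one, of opposite orientation. Invariance
  of \<open>\<mu>\<close> then gives \<open>\<phi>(b') = 2t - \<phi>(b)\<close> for the leading unit vectors \<open>b, b'\<close> of the two frames,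
  and the intermediate value theorem on the circle applies. For \<open>t = 0\<close> a halving line suffices.

  The thresholds of the two lines need not be unique and cannot be chosen continuously in general;
  instead of continuity of \<open>\<phi>\<close> one uses that \<open>{b. \<phi>(b) \<le> t}\<close> and \<open>{b. \<phi>(b) \<ge> t}\<close> are closed, as
  projections of compact sets of triples \<open>(b, c, d)\<close>.
\<close>

section \<open>Half-spaces, and the quarter turn of the plane\<close>

definition half_space :: "'a::real_inner \<Rightarrow> real \<Rightarrow> 'a set" where
  "half_space a c = {x. c < a \<bullet> x}"

lemma half_space_measurable [measurable]:
  "half_space (a :: 'a::euclidean_space) c \<in> sets borel"
  by (simp add: half_space_def open_halfspace_gt)

lemma half_space_scaleR:
  "r > 0 \<Longrightarrow> half_space (r *\<^sub>R a) c = half_space a (c / r)"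
  by (auto simp: half_space_def field_simps)

definition rot :: "real^2 \<Rightarrow> real^2" where
  "rot x = vector [- x $ 2, x $ 1]"

lemma rot_nth [simp]: "rot x $ 1 = - x $ 2" "rot x $ 2 = x $ 1"
  by (simp_all add: rot_def)

lemma inner_vec2: "x \<bullet> y = x $ 1 * y $ 1 + x $ 2 * y $ 2" for x y :: "real^2"
  by (simp add: inner_vec_def sum_2)

lemma bounded_linear_rot: "bounded_linear rot"
  by (intro linear_conv_bounded_linear[THEN iffD1] linearI) (auto simp: vec_eq_iff forall_2)

lemmas continuous_on_rot [continuous_intros] =
  bounded_linear.continuous_on[OF bounded_linear_rot]

lemma rot_scaleR: "rot (r *\<^sub>R x) = r *\<^sub>R rot x"
  by (simp add: vec_eq_iff forall_2)

lemma inner_rot [simp]: "x \<bullet> rot x = 0" "rot x \<bullet> x = 0"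
  by (simp_all add: inner_vec2)

lemma norm_rot [simp]: "norm (rot x) = norm x"
  by (simp add: norm_eq_sqrt_inner inner_vec2)

lemma rot_eq_0_iff [simp]: "rot x = 0 \<longleftrightarrow> x = 0"
  by (metis norm_eq_zero norm_rot)

lemma rot_rot [simp]: "rot (rot x) = - x"
  by (simp add: vec_eq_iff forall_2)

lemma orthogonal_imp_multiple_rot:
  fixes x y :: "real^2"
  assumes "x \<noteq> 0" "x \<bullet> y = 0"
  shows "y = ((y \<bullet> rot x) / (x \<bullet> x)) *\<^sub>R rot x"
proof -
  have "x \<bullet> x \<noteq> 0" using assms by simp
  moreover have "(x \<bullet> x) *\<^sub>R y = (y \<bullet> rot x) *\<^sub>R rot x"
    using assms(2) by (simp add: vec_eq_iff forall_2 inner_vec2) algebra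
  ultimately show ?thesis
    by (metis (no_types, lifting) divide_inverse mult.commute scaleR_scaleR left_inverse scaleR_one)
qed

text \<open>For plane vectors, \<open>y \<bullet> rot x\<close> is the determinant with columns
  \<open>x\<close>, \<open>y\<close>, so this is multiplicativity of the determinant. Its sign tells
  on which side of \<open>A *v x\<close> the image of \<open>rot x\<close> lies.\<close>

lemma inner_matrix_rot:
  fixes A :: "real^2^2"
  shows "(A *v rot x) \<bullet> rot (A *v x) = det A * (x \<bullet> x)"
  by (simp add: inner_vec2 det_2 matrix_vector_mult_def sum_2 algebra_simps)

text \<open>A quarter turn sends the pair \<open>x\<close>, \<open>rot x\<close> to
  \<open>rot x\<close>, \<open>- x\<close>, which flips the sign of the inner product of the images.
  This product therefore vanishes somewhere on the connected circle.\<close>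

lemma ex_unit_rot_matrix_orthogonal:
  fixes A :: "real^2^2"
  shows "\<exists>x. norm x = 1 \<and> (A *v x) \<bullet> (A *v rot x) = 0"
proof -
  define h where "h x = (A *v x) \<bullet> (A *v rot x)" for x
  have "continuous_on (sphere 0 1) h"
    unfolding h_def by (intro continuous_intros bounded_linear.continuous_on[OF matrix_vector_mul_bounded_linear])
  then have conn: "connected (h ` sphere 0 1)"
    by (intro connected_continuous_image connected_sphere) auto
  have odd: "h (rot x) = - h x" for x
    by (simp add: h_def linear_neg[OF matrix_vector_mul_linear] inner_commute)
  obtain e :: "real^2" where e: "norm e = 1" using vector_choose_size[of 1] by auto
  have mem: "h e \<in> h ` sphere 0 1" "h (rot e) \<in> h ` sphere 0 1"
    using e by (auto intro!: imageI)
  have "0 \<in> h ` sphere 0 1"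
  proof (cases "h e \<le> 0")
    case True
    then show ?thesis
      using connectedD_interval[OF conn mem, of 0] odd[of e] by simp
  next
    case False
    then show ?thesis
      using connectedD_interval[OF conn mem(2,1), of 0] odd[of e] by simp
  qed
  then show ?thesis by (auto simp: h_def)
qed

section \<open>Probability measures that vanish on hyperplanes, in any dimension\<close>

locale hyperplane_null = prob_space M for M :: "'a::euclidean_space measure" +
  assumes sets_eq [measurable_cong]: "sets M = sets borel"
    and hyperplane_null: "a \<noteq> 0 \<Longrightarrow> measure M {x. a \<bullet> x = c} = 0"
begin

lemma space_eq [simp]: "space M = UNIV"
  using sets_eq_imp_space_eq[OF sets_eq] by simp

lemma half_space_sets [measurable]: "half_space a c \<in> sets M"
  by (simp add: sets_eq half_space_measurable)

lemma AE_off_hyperplane: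
  assumes "a \<noteq> 0"
  shows "AE x in M. a \<bullet> x \<noteq> c"
proof (rule AE_I)
  show "{x \<in> space M. \<not> a \<bullet> x \<noteq> c} \<subseteq> {x. a \<bullet> x = c}" by auto
  show "emeasure M {x. a \<bullet> x = c} = 0"
    using hyperplane_null[OF assms, of c] by (simp add: emeasure_eq_measure)
  show "{x. a \<bullet> x = c} \<in> sets M"
    by (simp add: sets_eq closed_hyperplane)
qed

lemma tendsto_indicator_half_space:
  assumes "\<alpha> \<longlonglongrightarrow> a" "\<gamma> \<longlonglongrightarrow> c" "a \<bullet> x \<noteq> c"
  shows "(\<lambda>n. indicator (half_space (\<alpha> n) (\<gamma> n)) x) \<longlonglongrightarrow> (indicator (half_space a c) x :: real)"
proof -
  have lim: "(\<lambda>n. \<alpha> n \<bullet> x - \<gamma> n) \<longlonglongrightarrow> a \<bullet> x - c"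
    using assms by (intro tendsto_intros)
  have "\<forall>\<^sub>F n in sequentially. indicator (half_space (\<alpha> n) (\<gamma> n)) x = (indicator (half_space a c) x :: real)"
  proof (cases "a \<bullet> x > c")
    case True
    then have "\<forall>\<^sub>F n in sequentially. \<alpha> n \<bullet> x - \<gamma> n > 0"
      using order_tendstoD(1)[OF lim, of 0] by simp
    then show ?thesis by eventually_elim (use True in \<open>auto simp: half_space_def indicator_def\<close>)
  next
    case False
    then have "\<forall>\<^sub>F n in sequentially. \<alpha> n \<bullet> x - \<gamma> n < 0"
      using order_tendstoD(2)[OF lim, of 0] assms by simp
    then show ?thesis by eventually_elim (use False in \<open>auto simp: half_space_def indicator_def\<close>)
  qed
  then show ?thesis by (rule tendsto_eventually)
qed

text \<open>Dominated convergence: the indicators converge off the two limiting hyperplanes, which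
  are null sets. Normals and thresholds may vary together.\<close>

lemma tendsto_measure_half_spaces:
  assumes "\<alpha> \<longlonglongrightarrow> a" "\<gamma> \<longlonglongrightarrow> c" "a \<noteq> 0" "\<beta> \<longlonglongrightarrow> b" "\<delta> \<longlonglongrightarrow> d" "b \<noteq> 0"
  shows "(\<lambda>n. measure M (half_space (\<alpha> n) (\<gamma> n) \<inter> half_space (\<beta> n) (\<delta> n)))
    \<longlonglongrightarrow> measure M (half_space a c \<inter> half_space b d)"
proof -
  have "(\<lambda>n. LINT x|M. indicator (half_space (\<alpha> n) (\<gamma> n) \<inter> half_space (\<beta> n) (\<delta> n)) x)
      \<longlonglongrightarrow> (LINT x|M. indicator (half_space a c \<inter> half_space b d) x :: real)"
  proof (rule integral_dominated_convergence[where w = "\<lambda>_. 1"])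
    show "AE x in M. (\<lambda>n. indicator (half_space (\<alpha> n) (\<gamma> n) \<inter> half_space (\<beta> n) (\<delta> n)) x)
        \<longlonglongrightarrow> (indicator (half_space a c \<inter> half_space b d) x :: real)"
      using AE_off_hyperplane[OF assms(3), of c] AE_off_hyperplane[OF assms(6), of d]
      by eventually_elim
        (auto simp: indicator_inter_arith intro!: tendsto_mult tendsto_indicator_half_space assms)
  qed (auto simp: indicator_def)
  then show ?thesis by simp
qed

lemma continuous_on_measure_half_spaces [continuous_intros]:
  fixes f g :: "'b::metric_space \<Rightarrow> 'a"
  assumes "continuous_on S f" "continuous_on S u" "\<And>x. x \<in> S \<Longrightarrow> f x \<noteq> 0"
    and "continuous_on S g" "continuous_on S v" "\<And>x. x \<in> S \<Longrightarrow> g x \<noteq> 0"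
  shows "continuous_on S (\<lambda>x. measure M (half_space (f x) (u x) \<inter> half_space (g x) (v x)))"
  unfolding continuous_on_sequentially comp_def
proof (intro allI ballI impI)
  fix x :: "nat \<Rightarrow> 'b" and a
  assume a: "a \<in> S" and x: "(\<forall>n. x n \<in> S) \<and> x \<longlonglongrightarrow> a"
  show "(\<lambda>n. measure M (half_space (f (x n)) (u (x n)) \<inter> half_space (g (x n)) (v (x n))))
      \<longlonglongrightarrow> measure M (half_space (f a) (u a) \<inter> half_space (g a) (v a))"
    using assms a x
    by (intro tendsto_measure_half_spaces) (auto simp: continuous_on_sequentially comp_def)
qed

lemma continuous_on_measure_half_space [continuous_intros]:
  fixes f :: "'b::metric_space \<Rightarrow> 'a"
  assumes "continuous_on S f" "continuous_on S u" "\<And>x. x \<in> S \<Longrightarrow> f x \<noteq> 0"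
  shows "continuous_on S (\<lambda>x. measure M (half_space (f x) (u x)))"
  using continuous_on_measure_half_spaces[OF assms assms] by simp

lemma ex_norm_tail_less:
  assumes "e > 0"
  shows "\<exists>r. measure M {x. r < norm x} < e"
proof -
  have "(\<lambda>n. measure M {x. real n < norm x}) \<longlonglongrightarrow> measure M (\<Inter>n. {x. real n < norm x})"
    by (rule finite_Lim_measure_decseq) (auto simp: decseq_def sets_eq)
  moreover have "(\<Inter>n. {x::'a. real n < norm x}) = {}"
    using reals_Archimedean2 by (fastforce dest: less_asym)
  ultimately have "(\<lambda>n. measure M {x. real n < norm x}) \<longlonglongrightarrow> 0" by simp
  from order_tendstoD(2)[OF this assms] show ?thesis
    by (auto simp: eventually_sequentially)
qed

text \<open>A large positive threshold puts the half-space outside a ball of almost full mass, a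
  large negative one makes it contain that ball. The bound is uniform in the unit normal, as
  compactness of the set of frames requires.\<close>

lemma half_space_level_bounded:
  assumes "0 < s" "s < 1"
  shows "\<exists>r. \<forall>a c. norm a = 1 \<and> measure M (half_space a c) = s \<longrightarrow> \<bar>c\<bar> \<le> r"
proof -
  obtain r where r: "measure M {x. r < norm x} < min s (1 - s)"
    using ex_norm_tail_less[of "min s (1 - s)"] assms by auto
  have tail: "{x. r < norm x} \<in> sets M" by (simp add: sets_eq)
  have "\<bar>c\<bar> \<le> r" if a: "norm a = 1" and s: "measure M (half_space a c) = s" for a c
  proof (rule ccontr)
    assume c: "\<not> \<bar>c\<bar> \<le> r"
    have le: "\<bar>a \<bullet> x\<bar> \<le> norm x" for x
      using Cauchy_Schwarz_ineq2[of a x] a by simp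
    show False
    proof (cases "c > 0")
      case True
      have "half_space a c \<subseteq> {x. r < norm x}"
      proof
        fix x :: 'a assume "x \<in> half_space a c"
        then show "x \<in> {x. r < norm x}" using c True le[of x] by (auto simp: half_space_def)
      qed
      then have "s \<le> measure M {x. r < norm x}"
        using finite_measure_mono[OF _ tail] s by blast
      then show False using r by simp
    next
      case False
      have "- {x. r < norm x} \<subseteq> half_space a c"
      proof
        fix x :: 'a assume "x \<in> - {x. r < norm x}"
        then show "x \<in> half_space a c" using c False le[of x] by (auto simp: half_space_def)
      qed
      then have "measure M (- {x. r < norm x}) \<le> s"
        using finite_measure_mono[OF _ half_space_sets] s by blast
      then show False using r prob_compl[OF tail] by (simp add: Compl_eq_Diff_UNIV)
    qed
  qed
  then show ?thesis by blast
qed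

text \<open>The mass is continuous in the threshold and tends to 0 and 1 at the two ends of the real
  line.\<close>

lemma ex_half_space_level:
  assumes "0 < s" "s < 1" "a \<noteq> 0"
  shows "\<exists>c. measure M (half_space a c) = s"
proof -
  define F where "F c = measure M (half_space a c)" for c
  have "continuous_on UNIV F"
    unfolding F_def using assms by (intro continuous_intros)
  then have conn: "connected (range F)"
    by (intro connected_continuous_image) auto
  have down: "(\<lambda>n. F (real n)) \<longlonglongrightarrow> measure M (\<Inter>n. half_space a (real n))"
    unfolding F_def by (rule finite_Lim_measure_decseq) (auto simp: decseq_def half_space_def)
  have "(\<Inter>n. half_space a (real n)) = {}"
    using reals_Archimedean2 by (fastforce simp: half_space_def dest: less_asym)
  with down have "(\<lambda>n. F (real n)) \<longlonglongrightarrow> 0" by simp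
  from order_tendstoD(2)[OF this assms(1)] obtain m where m: "F (real m) < s"
    by (auto simp: eventually_sequentially)
  have up: "(\<lambda>n. F (- real n)) \<longlonglongrightarrow> measure M (\<Union>n. half_space a (- real n))"
    unfolding F_def by (rule finite_Lim_measure_incseq) (auto simp: incseq_def half_space_def)
  have "x \<in> (\<Union>n. half_space a (- real n))" for x
    using reals_Archimedean2[of "- (a \<bullet> x)"] by (auto simp: half_space_def) (metis minus_less_iff)
  then have "(\<Union>n. half_space a (- real n)) = space M" by auto
  with up have "(\<lambda>n. F (- real n)) \<longlonglongrightarrow> 1" by (simp add: prob_space del: space_eq)
  from order_tendstoD(1)[OF this assms(2)] obtain k where k: "s < F (- real k)"
    by (auto simp: eventually_sequentially)
  have "s \<in> range F"
    using connectedD_interval[OF conn, of "F (real m)" "F (- real k)" s] m k by auto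
  then show ?thesis by (auto simp: F_def)
qed

text \<open>Negating normal and threshold gives the opposite open half-space; the two miss only a
  null hyperplane.\<close>

lemma measure_half_space_split:
  assumes "A \<in> sets M" "a \<noteq> 0"
  shows "measure M (A \<inter> half_space (- a) (- c)) = measure M A - measure M (A \<inter> half_space a c)"
proof -
  have "measure M (A \<inter> half_space (- a) (- c)) = measure M (A - half_space a c)"
    using AE_off_hyperplane[OF assms(2), of c] assms(1)
    by (intro measure_eq_AE) (auto simp: half_space_def elim!: AE_mp)
  then show ?thesis using assms(1) by (simp add: finite_measure_Diff')
qed

lemma measure_half_space_uminus:
  "a \<noteq> 0 \<Longrightarrow> measure M (half_space (- a) (- c)) = 1 - measure M (half_space a c)"
  using measure_half_space_split[of UNIV a c] prob_space sets.top[of M] by simp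

text \<open>A level does not determine its threshold, but different thresholds give half-spaces that
  differ by a null set.\<close>
lemma measure_Int_half_space_unique:
  assumes "measure M (half_space a c) = measure M (half_space a c')" "A \<in> sets M"
  shows "measure M (A \<inter> half_space a c) = measure M (A \<inter> half_space a c')"
  using assms
proof (induction c c' rule: linorder_wlog)
  case (le c c')
  have sub: "half_space a c' \<subseteq> half_space a c" using le by (auto simp: half_space_def)
  have "measure M (half_space a c - half_space a c') = 0"
    using finite_measure_Diff[OF _ _ sub] le by simp
  then have "AE x in M. x \<notin> half_space a c - half_space a c'"
    by (intro AE_not_in) (auto simp: null_sets_def emeasure_eq_measure)
  then show ?case
    using sub le by (intro measure_eq_AE) (auto elim!: AE_mp)
qed simp

end

section \<open>Quadrants of orthonormal frames with prescribed levels\<close>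

locale line_null = hyperplane_null M for M :: "(real^2) measure"
begin

definition quadrant :: "real^2 \<Rightarrow> real \<Rightarrow> real \<Rightarrow> real" where
  "quadrant b c d = measure M (half_space b d \<inter> half_space (rot b) c)"

definition frames :: "real \<Rightarrow> real \<Rightarrow> ((real^2) \<times> real \<times> real) set" where
  "frames r s = {(b, c, d). norm b = 1 \<and> measure M (half_space b d) = s
     \<and> measure M (half_space (rot b) c) = r}"

lemma continuous_on_quadrant:
  "continuous_on {(b, c, d). norm b = 1} (\<lambda>(b, c, d). quadrant b c d)"
  unfolding quadrant_def case_prod_unfold by (intro continuous_intros) auto

lemma closed_norm_fst: "closed {(b::real^2, c::real, d::real). norm b = 1}"
  unfolding case_prod_unfold by (intro closed_Collect_eq continuous_intros)

text \<open>The thresholds are bounded uniformly in the direction, and both level conditions are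
  closed because the masses depend continuously on the triple.\<close>

lemma compact_frames:
  assumes "0 < r" "r < 1" "0 < s" "s < 1"
  shows "compact (frames r s)"
proof -
  let ?S = "{(b::real^2, c::real, d::real). norm b = 1}"
  obtain u where u: "\<And>a c. norm a = 1 \<Longrightarrow> measure M (half_space a c) = r \<Longrightarrow> \<bar>c\<bar> \<le> u"
    using half_space_level_bounded[of r] assms by blast
  obtain v where v: "\<And>a c. norm a = 1 \<Longrightarrow> measure M (half_space a c) = s \<Longrightarrow> \<bar>c\<bar> \<le> v"
    using half_space_level_bounded[of s] assms by blast
  have "frames r s \<subseteq> cball 0 1 \<times> {-u..u} \<times> {-v..v}"
  proof clarify
    fix b c d assume "(b, c, d) \<in> frames r s"
    then show "b \<in> cball 0 1 \<and> (c, d) \<in> {-u..u} \<times> {-v..v}"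
      using u[of "rot b" c] v[of b d] by (auto simp: frames_def)
  qed
  then have "bounded (frames r s)"
    by (rule bounded_subset[rotated]) (intro bounded_Times bounded_cball bounded_closed_interval)
  moreover
  have "closed (?S \<inter> (\<lambda>(b, c, d). measure M (half_space b d)) -` {s})"
    by (intro continuous_closed_preimage closed_norm_fst)
      (auto simp: case_prod_unfold intro!: continuous_intros)
  moreover have "closed (?S \<inter> (\<lambda>(b, c, d). measure M (half_space (rot b) c)) -` {r})"
    by (intro continuous_closed_preimage closed_norm_fst)
      (auto simp: case_prod_unfold intro!: continuous_intros)
  moreover have "frames r s = (?S \<inter> (\<lambda>(b, c, d). measure M (half_space b d)) -` {s}) \<inter>
      (?S \<inter> (\<lambda>(b, c, d). measure M (half_space (rot b) c)) -` {r})"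
    by (auto simp: frames_def)
  ultimately show ?thesis
    by (metis closed_Int compact_eq_bounded_closed)
qed

lemma closed_frame_directions:
  assumes "0 < r" "r < 1" "0 < s" "s < 1" "closed T"
  shows "closed (fst ` (frames r s \<inter> (\<lambda>(b, c, d). quadrant b c d) -` T))"
proof -
  have "closed ({(b, c, d). norm b = 1} \<inter> (\<lambda>(b, c, d). quadrant b c d) -` T)"
    by (rule continuous_closed_preimage[OF continuous_on_quadrant closed_norm_fst assms(5)])
  then have "compact (frames r s \<inter> ({(b, c, d). norm b = 1} \<inter> (\<lambda>(b, c, d). quadrant b c d) -` T))"
    by (rule compact_Int_closed[OF compact_frames[OF assms(1-4)]])
  moreover have "frames r s \<inter> ({(b, c, d). norm b = 1} \<inter> (\<lambda>(b, c, d). quadrant b c d) -` T) =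
      frames r s \<inter> (\<lambda>(b, c, d). quadrant b c d) -` T"
    by (auto simp: frames_def)
  ultimately show ?thesis
    by (auto intro!: compact_imp_closed compact_continuous_image continuous_intros)
qed

lemma ex_frame:
  assumes "0 < r" "r < 1" "0 < s" "s < 1" "norm b = 1"
  shows "\<exists>c d. (b, c, d) \<in> frames r s"
proof -
  have "b \<noteq> 0" using assms(5) by auto
  then show ?thesis
    using ex_half_space_level[of r "rot b"] ex_half_space_level[of s b] assms
    by (auto simp: frames_def)
qed

text \<open>Exchanging one threshold at a time leaves the mass unchanged, so it depends on the
  direction \<open>b\<close> alone.\<close>

lemma quadrant_unique:
  assumes "(b, c, d) \<in> frames r s" "(b, c', d') \<in> frames r s"
  shows "quadrant b c d = quadrant b c' d'"
proof -
  have "quadrant b c d = quadrant b c' d"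
    unfolding quadrant_def using assms
    by (intro measure_Int_half_space_unique) (auto simp: frames_def)
  also have "\<dots> = measure M (half_space (rot b) c' \<inter> half_space b d)"
    by (simp add: quadrant_def Int_commute)
  also have "\<dots> = measure M (half_space (rot b) c' \<inter> half_space b d')"
    using assms by (intro measure_Int_half_space_unique) (auto simp: frames_def)
  finally show ?thesis by (simp add: quadrant_def Int_commute)
qed

text \<open>The directions with value at most \<open>t\<close> and those with value at least
  \<open>t\<close> form two nonempty closed sets covering the circle, so they share a direction.
  There \<open>quadrant_unique\<close> identifies the two values.\<close>

lemma frame_intermediate_value:
  assumes rs: "0 < r" "r < 1" "0 < s" "s < 1"
    and lo: "(b, c, d) \<in> frames r s" "quadrant b c d \<le> t"
    and hi: "(b', c', d') \<in> frames r s" "t \<le> quadrant b' c' d'"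
  shows "\<exists>b c d. (b, c, d) \<in> frames r s \<and> quadrant b c d = t"
proof -
  define D where "D T = fst ` (frames r s \<inter> (\<lambda>(b, c, d). quadrant b c d) -` T)" for T
  have "connected (sphere (0::real^2) 1)" by (rule connected_sphere) simp
  moreover have "closed (D {..t})" "closed (D {t..})"
    unfolding D_def by (intro closed_frame_directions rs; simp)+
  moreover have "sphere 0 1 \<subseteq> D {..t} \<union> D {t..}"
  proof
    fix x :: "real^2" assume "x \<in> sphere 0 1"
    then obtain u v where uv: "(x, u, v) \<in> frames r s" using ex_frame[OF rs, of x] by auto
    then show "x \<in> D {..t} \<union> D {t..}"
      by (cases "quadrant x u v \<le> t") (force simp: D_def)+
  qed
  moreover have "b \<in> D {..t} \<inter> sphere 0 1" "b' \<in> D {t..} \<inter> sphere 0 1"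
    using lo hi by (force simp: D_def frames_def)+
  ultimately have "D {..t} \<inter> D {t..} \<inter> sphere 0 1 \<noteq> {}"
    unfolding connected_closed by blast
  then obtain x u v u' v' where "(x, u, v) \<in> frames r s" "quadrant x u v \<le> t"
      "(x, u', v') \<in> frames r s" "t \<le> quadrant x u' v'"
    by (auto simp: D_def)
  then show ?thesis using quadrant_unique by (metis order_antisym)
qed

text \<open>The pair \<open>b, rot b\<close> is chosen so that the transpose of \<open>L\<close> keeps it orthogonal. As
  \<open>L\<close> reverses orientation, the image of \<open>rot b\<close> is a positive multiple of \<open>- rot b'\<close>, so the
  quadrant of \<open>b\<close> corresponds to the neighbour of the quadrant of \<open>b'\<close> in the same half-plane.\<close>
lemma ex_reflected_frame:
  fixes L :: "real^2^2"
  assumes inv: "distr M borel (\<lambda>x. L *v x + z) = M" and det: "det L < 0"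
    and rs: "0 < s" "s < 1"
  shows "\<exists>b c d b' c' d'. (b, c, d) \<in> frames (1/2) s \<and> (b', c', d') \<in> frames (1/2) s \<and>
    quadrant b' c' d' = s - quadrant b c d"
proof -
  \<comment> \<open>Pulling a half-space back along the affine map applies \<open>A\<close> to its
    normal.\<close>
  define A where "A = transpose L"
  obtain b where b: "norm b = 1" and orth: "(A *v b) \<bullet> (A *v rot b) = 0"
    using ex_unit_rot_matrix_orthogonal by blast
  obtain c d where frame: "(b, c, d) \<in> frames (1/2) s"
    using ex_frame[OF _ _ rs b, of "1/2"] by auto
  define p where "p = norm (A *v b)"
  define b' where "b' = (1 / p) *\<^sub>R (A *v b)"
  have neg: "(A *v rot b) \<bullet> rot (A *v b) < 0"
    unfolding inner_matrix_rot using det b by (simp add: A_def dot_square_norm)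
  then have Ab: "A *v b \<noteq> 0" by (metis inner_zero_right less_irrefl rot_eq_0_iff)
  then have p: "p > 0" by (simp add: p_def)
  have b': "norm b' = 1" "b' \<noteq> 0" using p by (auto simp: b'_def p_def)
  have Ab_eq: "A *v b = p *\<^sub>R b'" using p by (simp add: b'_def)
  \<comment> \<open>\<open>k\<close> is negative and \<open>q\<close> is the length of
    \<open>A *v rot b\<close>. The sign goes into \<open>- rot b'\<close>, since
    \<open>half_space_scaleR\<close> needs a positive factor.\<close>
  define k where "k = (A *v rot b) \<bullet> rot (A *v b)"
  define q where "q = - k / p"
  have q: "q > 0" using neg p by (simp add: q_def k_def divide_neg_pos)
  have Arot_eq: "A *v rot b = q *\<^sub>R (- rot b')"
  proof -
    have "A *v rot b = (k / p\<^sup>2) *\<^sub>R rot (A *v b)"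
      using orthogonal_imp_multiple_rot[OF Ab orth] by (simp add: dot_square_norm p_def k_def)
    also have "rot (A *v b) = p *\<^sub>R rot b'" by (simp add: Ab_eq rot_scaleR)
    finally show ?thesis using p by (simp add: q_def power2_eq_square)
  qed
  have vimage: "(\<lambda>x. L *v x + z) -` half_space a e = half_space (A *v a) (e - a \<bullet> z)" for a e
    by (auto simp: half_space_def inner_add_right A_def dot_lmul_matrix algebra_simps
        simp flip: dot_lmul_matrix)
  have meas: "(\<lambda>x. L *v x + z) \<in> measurable M borel"
    unfolding measurable_cong_sets[OF sets_eq refl]
    by (intro borel_measurable_continuous_onI continuous_intros
        bounded_linear.continuous_on[OF matrix_vector_mul_bounded_linear])
  have pull: "measure M E = measure M ((\<lambda>x. L *v x + z) -` E)" if "E \<in> sets borel" for E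
    using measure_distr[OF meas that] inv by simp
  \<comment> \<open>These are the thresholds of the pulled-back half-spaces after normalising the
    normals; \<open>c'\<close> is negated because the normal there is
    \<open>- rot b'\<close>.\<close>
  define d' where "d' = (d - b \<bullet> z) / p"
  define c' where "c' = - ((c - rot b \<bullet> z) / q)"
  have Vb: "(\<lambda>x. L *v x + z) -` half_space b d = half_space b' d'"
    using p by (simp add: vimage Ab_eq half_space_scaleR d'_def)
  have Vr: "(\<lambda>x. L *v x + z) -` half_space (rot b) c = half_space (- rot b') (- c')"
    unfolding vimage Arot_eq using q by (subst half_space_scaleR) (auto simp: c'_def)
  have s': "measure M (half_space b' d') = s"
    using frame pull[of "half_space b d"] Vb by (simp add: frames_def half_space_measurable)
  have "measure M (half_space (- rot b') (- c')) = 1/2"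
    using frame pull[of "half_space (rot b) c"] Vr by (simp add: frames_def half_space_measurable)
  then have "measure M (half_space (rot b') c') = 1/2"
    using measure_half_space_uminus[of "rot b'" c'] b' by simp
  with s' have "(b', c', d') \<in> frames (1/2) s" by (simp add: frames_def b')
  moreover have "quadrant b c d = measure M (half_space b' d' \<inter> half_space (- rot b') (- c'))"
    unfolding quadrant_def
    by (subst pull) (auto simp: half_space_measurable vimage_Int Vb Vr)
  then have "quadrant b' c' d' = s - quadrant b c d"
    using measure_half_space_split[of "half_space b' d'" "rot b'" c'] b' s'
    by (simp add: quadrant_def)
  ultimately show ?thesis using frame by blast
qed

end

section \<open>The partition and its four masses\<close>

theorem theorem1p5:
  fixes \<mu> :: "(real^2) measure" and R :: "real^2 \<Rightarrow> real^2"
    and L :: "real^2^2" and b :: "real^2" and t :: real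
  assumes "prob_space \<mu>" and "sets \<mu> = sets borel"
    and "\<And>l. is_line l \<Longrightarrow> measure \<mu> l = 0"
    and "R = (\<lambda>x. L *v x + b)" and "R \<circ> R = id" and "det L < 0"
    and "distr \<mu> borel R = \<mu>"
    and "0 \<le> t" and "t \<le> 1/4"
  shows "(\<exists>l m Qs. orthogonal_regions l m Qs \<and>
            map (measure \<mu>) Qs = [t, t, 1/2 - t, 1/2 - t]) \<or>
         (t = 0 \<and> (\<exists>l H K. open_half_planes l H K \<and> measure \<mu> H = 1/2 \<and> measure \<mu> K = 1/2))"
proof -
  interpret prob_space \<mu> by fact
  interpret line_null \<mu>
    by standard (use assms(2,3) is_line_iff_hyperplane in blast)+
  have half_space_lt: "{x. a \<bullet> x < c} = half_space (- a) (- c)" for a :: "real^2" and c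
    by (auto simp: half_space_def)
  show ?thesis
  proof (cases "t = 0")
    \<comment> \<open>The level \<open>2 * t\<close> is now 0, outside the range of the frame
      lemmas; any direction gives a halving line for the degenerate partition.\<close>
    case True
    define a :: "real^2" where "a = axis 1 1"
    have a: "a \<noteq> 0" by (simp add: a_def)
    obtain c where c: "measure \<mu> (half_space a c) = 1/2"
      using ex_half_space_level[of "1/2" a] a by auto
    then have "measure \<mu> {x. a \<bullet> x < c} = 1/2"
      using measure_half_space_uminus[OF a, of c] by (simp add: half_space_lt)
    with c a True show ?thesis unfolding open_half_planes_def half_space_def by blast
  next
    case False
    with assms(8,9) have s: "0 < 2 * t" "2 * t < 1" by auto
    obtain u c d u' c' d' where
      f: "(u, c, d) \<in> frames (1/2) (2 * t)" "(u', c', d') \<in> frames (1/2) (2 * t)"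
        "quadrant u' c' d' = 2 * t - quadrant u c d"
      using ex_reflected_frame[of L b "2 * t"] assms(4,6,7) s by blast
    have "\<exists>u c d. (u, c, d) \<in> frames (1/2) (2 * t) \<and> quadrant u c d = t"
    \<comment> \<open>The two quadrant masses have mean \<open>t\<close>, so one is at most
      \<open>t\<close> and the other at least \<open>t\<close>.\<close>
    proof (cases "quadrant u c d \<le> t")
      case True
      with f show ?thesis by (intro frame_intermediate_value[OF _ _ s f(1) _ f(2)]) auto
    next
      case False
      with f show ?thesis by (intro frame_intermediate_value[OF _ _ s f(2) _ f(1)]) auto
    qed
    then obtain v p q where v: "(v, p, q) \<in> frames (1/2) (2 * t)" "quadrant v p q = t" by blast
    let ?a = "rot v"
    have v0: "v \<noteq> 0" using v(1) by (auto simp: frames_def)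
    define Q where "Q = [half_space v q \<inter> half_space ?a p, half_space v q \<inter> half_space (- ?a) (- p),
      half_space (- ?a) (- p) \<inter> half_space (- v) (- q), half_space ?a p \<inter> half_space (- v) (- q)]"
    have "Q = [{x. ?a \<bullet> x > p \<and> v \<bullet> x > q}, {x. ?a \<bullet> x < p \<and> v \<bullet> x > q},
        {x. ?a \<bullet> x < p \<and> v \<bullet> x < q}, {x. ?a \<bullet> x > p \<and> v \<bullet> x < q}]"
      by (auto simp: Q_def half_space_def)
    then have "orthogonal_regions {x. ?a \<bullet> x = p} {x. v \<bullet> x = q} Q"
      unfolding orthogonal_regions_def using v0
      by (intro exI[of _ ?a] exI[of _ p] exI[of _ v] exI[of _ q]) (simp add: orthogonal_def)
    moreover
    have v1: "measure \<mu> (half_space v q) = 2 * t" "measure \<mu> (half_space ?a p) = 1/2"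
      "measure \<mu> (half_space v q \<inter> half_space ?a p) = t"
      using v by (auto simp: frames_def quadrant_def)
    have v2: "measure \<mu> (half_space v q \<inter> half_space (- ?a) (- p)) = t"
      using measure_half_space_split[of "half_space v q" ?a p] v0 v1 by simp
    have v3: "measure \<mu> (half_space (- ?a) (- p)) = 1/2"
      using measure_half_space_uminus[of ?a p] v0 v1 by simp
    \<comment> \<open>Each side of the bisecting line has mass 1/2, and its part in
      \<open>half_space v q\<close> takes \<open>t\<close> of it.\<close>
    have "map (measure \<mu>) Q = [t, t, 1/2 - t, 1/2 - t]"
      using v1 v2 v3 measure_half_space_split[OF half_space_sets v0, of ?a p q]
        measure_half_space_split[OF half_space_sets v0, of "- ?a" "- p" q]
      by (simp add: Q_def Int_commute[of _ "half_space v q"])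
    ultimately show ?thesis by (intro disjI1 exI conjI)
  qed
qed

end
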